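(* Let $R$ be a ring and let $I$ be a regular ideal of $R$. Then the following are equivalent: (1) $I$ is square stable. (2) Whenever $aR+bR=R$ with $a\in 1+I$ and $b\in R$, there exists $y\in R$ such that $a^2+by\in U(R)$.
   Context: All rings are associative with identity and all ideals are two-sided. $U(R)$ denotes the set of all units of $R$. An ideal $I$ of a ring $R$ is square stable if whenever $aR+bR=R$ with $a\in I$ and $b\in R$, there exists $y\in R$ such that $a^2+by$ is a unit of $R$. An element $a\in R$ is regular if $a=axa$ for some $x\in R$. An ideal $I$ is regular if every element of $I$ is regular. *)

theory Defs
  imports "HOL-Algebra.AbelCoset" "HOL-Algebra.Ideal"
begin

(* For a, b in R, the sum of principal right ideals a R + b R is written
   (a <# carrier R) <+> (b <# carrier R): <# is the multiplicative left translate of a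
   set and <+> the additive sum of two sets.  Units R is the group of two-sided units. *)
definition square_stable :: "('a, 'm) ring_scheme \<Rightarrow> 'a set \<Rightarrow> bool" where
  "square_stable R I \<longleftrightarrow>
    (\<forall>a\<in>I. \<forall>b\<in>carrier R.
       (a <#\<^bsub>R\<^esub> carrier R) <+>\<^bsub>R\<^esub> (b <#\<^bsub>R\<^esub> carrier R) = carrier R \<longrightarrow>
       (\<exists>y\<in>carrier R. (a [^]\<^bsub>R\<^esub> (2::nat)) \<oplus>\<^bsub>R\<^esub> (b \<otimes>\<^bsub>R\<^esub> y) \<in> Units R))"

definition regular_element :: "('a, 'm) ring_scheme \<Rightarrow> 'a \<Rightarrow> bool" where
  "regular_element R a \<longleftrightarrow> (\<exists>x\<in>carrier R. a = a \<otimes>\<^bsub>R\<^esub> x \<otimes>\<^bsub>R\<^esub> a)"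

(* The inner inverse x ranges over the whole ring R, not only over I. *)
definition regular_ideal :: "('a, 'm) ring_scheme \<Rightarrow> 'a set \<Rightarrow> bool" where
  "regular_ideal R I \<longleftrightarrow> ideal I R \<and> (\<forall>a\<in>I. regular_element R a)"

end

theory Submission
  imports Defs "HOL-Algebra.Multiplicative_Group"
begin

text \<open>
  Over a noncommutative ring, square stability is far more than a stable range condition: if
  \<open>a\<^sup>2 + by\<close> is a unit, then \<open>a\<^sup>2R + bR = R\<close>, and this does not follow from \<open>aR + bR = R\<close>.
  For a regular ideal \<open>I\<close>, each of the two conditions turns out to say that \<open>I\<close> contains no
  nonzero element of square zero.

  Suppose \<open>n \<in> I\<close> with \<open>n\<^sup>2 = 0\<close> and \<open>n = nxn\<close>. Then \<open>n\<close> generates the right ideal of the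
  idempotent \<open>p = nx\<close>, but its square sees nothing of \<open>p\<close>. The right ideals of \<open>n\<close> and
  \<open>1 - p\<close> thus generate \<open>R\<close>, while \<open>p\<close> annihilates \<open>n\<^sup>2 + (1 - p)y\<close> from the left; if this
  element is a unit, then \<open>p = 0\<close> and \<open>n = pn = 0\<close>. For the condition on \<open>1 + I\<close>, the element
  \<open>n\<close> is completed to a small system of matrix units, with orthogonal idempotents \<open>p\<close> and \<open>q\<close>
  such that \<open>n \<in> pRq\<close>, and the same argument runs with \<open>a = n + (1 - p - q)\<close> and \<open>b = q\<close>
  (\<open>reduced_if_square_stable\<close>, \<open>reduced_if_square_condition_on_one_plus\<close>).

  Conversely, if \<open>I\<close> has no nonzero elements of square zero, then its idempotents are central
  (\<open>idempotent_central_if_reduced\<close>). Central idempotents split the ring, and the splitting can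
  be chosen so that \<open>a\<close> is invertible in one factor, while \<open>bR\<close> contains everything in the other
  factor that is needed to correct \<open>a\<^sup>2\<close> to the identity there. Such an element is a unit
  (\<open>corner_square_plus_complement_Unit\<close>), which gives \<open>square_stable_if_reduced\<close> and
  \<open>square_condition_on_one_plus_if_reduced\<close>.
\<close>

section \<open>Calculations in noncommutative rings\<close>

text \<open>
  In an ideal the absence of nonzero elements of square zero already excludes all nonzero nilpotent
  elements, so for ideals this is the usual notion of being reduced.
\<close>

definition reduced_set :: "('a, 'm) ring_scheme \<Rightarrow> 'a set \<Rightarrow> bool" where
  "reduced_set R I \<longleftrightarrow> (\<forall>n\<in>I. n \<otimes>\<^bsub>R\<^esub> n = \<zero>\<^bsub>R\<^esub> \<longrightarrow> n = \<zero>\<^bsub>R\<^esub>)"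

context ring
begin

text \<open>
  The simplification rules for rings cancel a summand only against an adjacent opposite one, but
  in their ordered normal form other summands can stand between the two. The rules below
  cancel across these.
\<close>

lemma add_minus_cancel_between:
  assumes "x \<in> carrier R" "y \<in> carrier R" "z \<in> carrier R"
  shows "x \<oplus> (y \<oplus> (\<ominus> x \<oplus> z)) = y \<oplus> z"
proof -
  have "x \<oplus> (y \<oplus> (\<ominus> x \<oplus> z)) = x \<oplus> (\<ominus> x \<oplus> (y \<oplus> z))"
    using assms by (simp add: a_lcomm)
  then show ?thesis using assms by (simp add: r_neg2)
qed

lemma add_minus_cancel_around:
  "x \<in> carrier R \<Longrightarrow> y \<in> carrier R \<Longrightarrow> x \<oplus> (y \<oplus> \<ominus> x) = y"
  using add_minus_cancel_between[of x y \<zero>] by simp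

lemma add_minus_cancel_between2:
  assumes "x \<in> carrier R" "y \<in> carrier R" "z \<in> carrier R" "w \<in> carrier R"
  shows "x \<oplus> (y \<oplus> (z \<oplus> (\<ominus> x \<oplus> w))) = y \<oplus> (z \<oplus> w)"
  using add_minus_cancel_between[of x "y \<oplus> z" w] assms by (simp add: a_assoc)

lemmas noncommutative_ring_simps =
  ring_simprules add_minus_cancel_around add_minus_cancel_between add_minus_cancel_between2

lemma comaximal_if_eq_one:
  assumes ab: "a \<in> carrier R" "b \<in> carrier R"
    and st: "s \<in> carrier R" "t \<in> carrier R" and one: "a \<otimes> s \<oplus> b \<otimes> t = \<one>"
  shows "(a <# carrier R) <+> (b <# carrier R) = carrier R"
proof
  show "(a <# carrier R) <+> (b <# carrier R) \<subseteq> carrier R"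
    using ab by (auto simp: set_add_def' l_coset_def)
  show "carrier R \<subseteq> (a <# carrier R) <+> (b <# carrier R)"
  proof
    fix r assume r: "r \<in> carrier R"
    have "r = (a \<otimes> s \<oplus> b \<otimes> t) \<otimes> r" using one r by simp
    also have "\<dots> = a \<otimes> (s \<otimes> r) \<oplus> b \<otimes> (t \<otimes> r)"
      using ab st r by (simp add: l_distr m_assoc)
    finally show "r \<in> (a <# carrier R) <+> (b <# carrier R)"
      using st r by (auto simp: set_add_def' l_coset_def)
  qed
qed

lemma comaximalE:
  assumes "(a <# carrier R) <+> (b <# carrier R) = carrier R"
  obtains s t where "s \<in> carrier R" "t \<in> carrier R" "a \<otimes> s \<oplus> b \<otimes> t = \<one>"
proof -
  have "\<one> \<in> (a <# carrier R) <+> (b <# carrier R)" unfolding assms by simp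
  then obtain s t where "s \<in> carrier R" "t \<in> carrier R" "\<one> = a \<otimes> s \<oplus> b \<otimes> t"
    by (auto simp: set_add_def' l_coset_def)
  then show thesis using that[of s t] by simp
qed

section \<open>Both conditions exclude elements of square zero\<close>

lemma square_eq_mult: "a \<in> carrier R \<Longrightarrow> a [^] (2::nat) = a \<otimes> a"
  by (simp add: numeral_2_eq_2)

lemma zero_of_mult_Unit:
  assumes "p \<in> carrier R" "u \<in> Units R" "p \<otimes> u = \<zero>"
  shows "p = \<zero>"
proof -
  have "p = (p \<otimes> u) \<otimes> inv u" using assms(1,2) by (simp add: m_assoc Units_closed)
  then show ?thesis using assms(2,3) by simp
qed

lemma regular_idealE:
  assumes "regular_ideal R I" "a \<in> I"
  obtains x where "a \<in> carrier R" "x \<in> carrier R" "a \<otimes> x \<otimes> a = a"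
    "a \<otimes> x \<in> I" "x \<otimes> a \<in> I"
proof -
  have I: "ideal I R" using assms by (simp add: regular_ideal_def)
  obtain x where x: "x \<in> carrier R" "a = a \<otimes> x \<otimes> a"
    using assms by (auto simp: regular_ideal_def regular_element_def)
  interpret ideal I R by (fact I)
  show thesis
    using x assms(2) by (intro that[of x]) (simp_all add: Icarr I_l_closed I_r_closed)
qed

text \<open>
  If \<open>n = nxn\<close> has square zero and \<open>p = nx\<close>, then \<open>n\<close> and \<open>1 - p\<close> are comaximal, but
  \<open>n\<^sup>2 + (1 - p)y\<close> lies in \<open>(1 - p)R\<close>, which contains a unit only if \<open>p = 0\<close>.
\<close>

lemma reduced_if_square_stable:
  assumes "regular_ideal R I" "square_stable R I"
  shows "reduced_set R I"
  unfolding reduced_set_def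
proof (intro ballI impI)
  fix n assume n: "n \<in> I" and nn: "n \<otimes> n = \<zero>"
  obtain x where x: "n \<in> carrier R" "x \<in> carrier R" "n \<otimes> x \<otimes> n = n"
    by (rule regular_idealE[OF assms(1) n]) blast
  define p where "p = n \<otimes> x"
  have p: "p \<in> carrier R" "p \<otimes> n = n" "p \<otimes> p = p"
    using x by (simp_all add: p_def m_assoc [symmetric])
  have "n \<otimes> x \<oplus> (\<one> \<ominus> p) \<otimes> \<one> = \<one>"
    using p(1) unfolding p_def[symmetric] by (simp add: noncommutative_ring_simps)
  then have "(n <# carrier R) <+> ((\<one> \<ominus> p) <# carrier R) = carrier R"
    using x p by (intro comaximal_if_eq_one[of n "\<one> \<ominus> p" x \<one>]) simp_all
  then obtain y where "y \<in> carrier R" "n [^] (2::nat) \<oplus> (\<one> \<ominus> p) \<otimes> y \<in> Units R"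
    using assms(2) n p(1) unfolding square_stable_def by (meson minus_closed one_closed)
  note y = this[unfolded square_eq_mult[OF x(1)]]
  have "p \<otimes> (n \<otimes> n \<oplus> (\<one> \<ominus> p) \<otimes> y) = (p \<ominus> p \<otimes> p) \<otimes> y"
    using p(1) y(1) unfolding nn by (simp add: noncommutative_ring_simps)
  also have "\<dots> = \<zero>" using p y by (simp add: a_minus_def r_neg)
  finally have "p = \<zero>" using zero_of_mult_Unit p y by blast
  then show "n = \<zero>" using p x by simp
qed

text \<open>
  Here \<open>n\<close> itself need not be congruent to \<open>1\<close> modulo \<open>I\<close>, so it is extended by the identity on a
  corner whose idempotent \<open>k\<close> annihilates \<open>n\<close> from both sides. Such a corner comes from
  \<open>w = (1 - p)xp\<close>, a quasi-inverse of \<open>n\<close> with \<open>w\<^sup>2 = 0\<close>: in terms of \<open>2 \<times> 2\<close> matrix units,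
  \<open>p = nw\<close> is \<open>e\<^sub>1\<^sub>1\<close>, \<open>n\<close> is \<open>e\<^sub>1\<^sub>2\<close>, \<open>w\<close> is \<open>e\<^sub>2\<^sub>1\<close>, \<open>q = wn\<close> is \<open>e\<^sub>2\<^sub>2\<close>, and \<open>k\<close> is the
  complement of \<open>e\<^sub>1\<^sub>1 + e\<^sub>2\<^sub>2\<close>. With \<open>a = n + k\<close> one has \<open>a(w + k) + q = 1\<close> but \<open>a\<^sup>2 = k\<close>, so that
  \<open>p\<close> annihilates \<open>a\<^sup>2 + qy\<close> from the left.
\<close>

lemma reduced_if_square_condition_on_one_plus:
  assumes reg: "regular_ideal R I"
    and sq: "\<forall>a \<in> \<one> <+ I. \<forall>b \<in> carrier R.
       (a <# carrier R) <+> (b <# carrier R) = carrier R \<longrightarrow>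
       (\<exists>y\<in>carrier R. (a [^] (2::nat)) \<oplus> (b \<otimes> y) \<in> Units R)"
  shows "reduced_set R I"
  unfolding reduced_set_def
proof (intro ballI impI)
  interpret ideal I R using reg by (simp add: regular_ideal_def)
  fix n assume nI: "n \<in> I" and nn: "n \<otimes> n = \<zero>"
  obtain x where n: "n \<in> carrier R" and x: "x \<in> carrier R" and nxn: "n \<otimes> x \<otimes> n = n"
      and nxI: "n \<otimes> x \<in> I"
    by (rule regular_idealE[OF reg nI]) blast
  define p where "p = n \<otimes> x"
  define w where "w = x \<otimes> p \<ominus> p \<otimes> x \<otimes> p"
  define q where "q = w \<otimes> n"
  define k where "k = \<one> \<ominus> (p \<oplus> q)"
  define a where "a = n \<oplus> k"
  have c: "p \<in> carrier R" "w \<in> carrier R" "q \<in> carrier R" "k \<in> carrier R" "a \<in> carrier R"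
    using n x by (simp_all add: p_def w_def q_def k_def a_def)
  note c = c n x
  have pn: "p \<otimes> n = n" using nxn by (simp add: p_def)
  have pp: "p \<otimes> p = p" using pn n x c by (simp add: p_def m_assoc [symmetric])
  have np: "n \<otimes> p = \<zero>" using nn n x by (simp add: p_def m_assoc [symmetric])
  have "p \<otimes> w = p \<otimes> x \<otimes> p \<ominus> p \<otimes> p \<otimes> x \<otimes> p"
    using c unfolding w_def by (simp add: noncommutative_ring_simps)
  then have pw: "p \<otimes> w = \<zero>" using c pp by (simp add: a_minus_def r_neg)
  have "w \<otimes> p = x \<otimes> (p \<otimes> p) \<ominus> p \<otimes> x \<otimes> (p \<otimes> p)"
    using c unfolding w_def by (simp add: noncommutative_ring_simps)
  then have wp: "w \<otimes> p = w" unfolding pp w_def .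
  have "n \<otimes> w = (n \<otimes> x) \<otimes> p \<ominus> (n \<otimes> p) \<otimes> x \<otimes> p"
    using c unfolding w_def by (simp add: noncommutative_ring_simps)
  then have nw: "n \<otimes> w = p"
    using c pp unfolding np p_def[symmetric] by (simp add: a_minus_def)
  have nq: "n \<otimes> q = n" using c nw pn by (simp add: q_def m_assoc [symmetric])
  have qn: "q \<otimes> n = \<zero>" using c nn by (simp add: q_def m_assoc)
  have qw: "q \<otimes> w = w" using c nw wp by (simp add: q_def m_assoc)
  have pq: "p \<otimes> q = \<zero>" using c pw by (simp add: q_def m_assoc [symmetric])
  have qp: "q \<otimes> p = \<zero>" using c np by (simp add: q_def m_assoc)
  have qq: "q \<otimes> q = q" using c qw by (simp add: q_def m_assoc [symmetric])
  have "n \<otimes> k = n \<ominus> (n \<otimes> p \<oplus> n \<otimes> q)" using c unfolding k_def by (simp add: noncommutative_ring_simps)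
  then have nk: "n \<otimes> k = \<zero>" using c np nq by (simp add: a_minus_def r_neg)
  have "k \<otimes> n = n \<ominus> (p \<otimes> n \<oplus> q \<otimes> n)" using c unfolding k_def by (simp add: noncommutative_ring_simps)
  then have kn: "k \<otimes> n = \<zero>" using c pn qn by (simp add: a_minus_def r_neg)
  have "k \<otimes> w = w \<ominus> (p \<otimes> w \<oplus> q \<otimes> w)" using c unfolding k_def by (simp add: noncommutative_ring_simps)
  then have kw: "k \<otimes> w = \<zero>" using c pw qw by (simp add: a_minus_def r_neg)
  have "p \<otimes> k = p \<ominus> (p \<otimes> p \<oplus> p \<otimes> q)" using c unfolding k_def by (simp add: noncommutative_ring_simps)
  then have pk: "p \<otimes> k = \<zero>" using c pp pq by (simp add: a_minus_def r_neg)
  have "q \<otimes> k = q \<ominus> (q \<otimes> p \<oplus> q \<otimes> q)" using c unfolding k_def by (simp add: noncommutative_ring_simps)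
  then have qk: "q \<otimes> k = \<zero>" using c qp qq by (simp add: a_minus_def r_neg)
  have "k \<otimes> k = k \<ominus> (p \<otimes> k \<oplus> q \<otimes> k)"
    using c(1,3,4) by (subst (1) k_def) (simp add: noncommutative_ring_simps)
  then have kk: "k \<otimes> k = k" using c pk qk by (simp add: a_minus_def)
  have "a \<otimes> a = n \<otimes> n \<oplus> n \<otimes> k \<oplus> (k \<otimes> n \<oplus> k \<otimes> k)"
    using c unfolding a_def by (simp add: noncommutative_ring_simps)
  then have aa: "a \<otimes> a = k" using c nn nk kn kk by simp
  have "a \<otimes> (w \<oplus> k) = (n \<otimes> w \<oplus> k \<otimes> w) \<oplus> (n \<otimes> k \<oplus> k \<otimes> k)"
    using c unfolding a_def by (simp add: noncommutative_ring_simps)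
  then have "a \<otimes> (w \<oplus> k) = p \<oplus> k" using c nw kw nk kk by simp
  then have "a \<otimes> (w \<oplus> k) \<oplus> q \<otimes> \<one> = p \<oplus> k \<oplus> q" using c by simp
  also have "\<dots> = \<one>" using c unfolding k_def by (simp add: noncommutative_ring_simps)
  finally have comax: "a \<otimes> (w \<oplus> k) \<oplus> q \<otimes> \<one> = \<one>" .
  have "n \<ominus> (p \<oplus> q) \<in> I"
    using nI nxI c by (simp add: a_minus_def p_def[symmetric] q_def I_l_closed)
  moreover have "a = \<one> \<oplus> (n \<ominus> (p \<oplus> q))" using c unfolding a_def k_def by (simp add: noncommutative_ring_simps)
  ultimately have "a \<in> \<one> <+ I" by (auto simp: a_l_coset_def')
  moreover have "(a <# carrier R) <+> (q <# carrier R) = carrier R"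
    using comaximal_if_eq_one[OF c(5) c(3) _ one_closed comax] c by simp
  ultimately obtain y where "y \<in> carrier R" "a [^] (2::nat) \<oplus> q \<otimes> y \<in> Units R"
    using sq c(3) by blast
  note y = this[unfolded square_eq_mult[OF c(5)]]
  have "p \<otimes> (a \<otimes> a \<oplus> q \<otimes> y) = p \<otimes> k \<oplus> (p \<otimes> q) \<otimes> y"
    using c y(1) unfolding aa by (simp add: noncommutative_ring_simps)
  also have "\<dots> = \<zero>" using y by (simp add: pk pq)
  finally have "p = \<zero>" using zero_of_mult_Unit c y by blast
  then show "n = \<zero>" using pn n by simp
qed

section \<open>Central idempotents and units\<close>

text \<open>
  The off-diagonal Peirce components \<open>er(1 - e)\<close> and \<open>(1 - e)re\<close> of any \<open>r\<close> lie in the ideal and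
  have square zero.
\<close>

lemma idempotent_central_if_reduced:
  assumes "ideal I R" "reduced_set R I" "e \<in> I" "e \<otimes> e = e" "r \<in> carrier R"
  shows "e \<otimes> r = r \<otimes> e"
proof -
  interpret ideal I R by fact
  have c: "e \<in> carrier R" "r \<in> carrier R" using assms Icarr by auto
  have "(e \<otimes> r \<ominus> e \<otimes> r \<otimes> e) \<otimes> (e \<otimes> r \<ominus> e \<otimes> r \<otimes> e)
      = e \<otimes> r \<otimes> (e \<ominus> e \<otimes> e) \<otimes> (r \<ominus> r \<otimes> e)"
    using c by (simp add: noncommutative_ring_simps)
  also have "\<dots> = \<zero>" using c assms(4) by (simp add: a_minus_def r_neg)
  finally have "(e \<otimes> r \<ominus> e \<otimes> r \<otimes> e) \<otimes> (e \<otimes> r \<ominus> e \<otimes> r \<otimes> e) = \<zero>" .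
  moreover have "e \<otimes> r \<ominus> e \<otimes> r \<otimes> e \<in> I"
    using assms(3) c by (simp add: a_minus_def I_r_closed)
  ultimately have "e \<otimes> r \<ominus> e \<otimes> r \<otimes> e = \<zero>"
    using assms(2) unfolding reduced_set_def by simp
  then have 1: "e \<otimes> r = e \<otimes> r \<otimes> e"
    using r_right_minus_eq[of "e \<otimes> r" "e \<otimes> r \<otimes> e"] c by (simp only: m_closed)
  have "(r \<otimes> e \<ominus> e \<otimes> r \<otimes> e) \<otimes> (r \<otimes> e \<ominus> e \<otimes> r \<otimes> e)
      = (r \<ominus> e \<otimes> r) \<otimes> (e \<ominus> e \<otimes> e) \<otimes> r \<otimes> e"
    using c by (simp add: noncommutative_ring_simps)
  also have "\<dots> = \<zero>" using c assms(4) by (simp add: a_minus_def r_neg)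
  finally have "(r \<otimes> e \<ominus> e \<otimes> r \<otimes> e) \<otimes> (r \<otimes> e \<ominus> e \<otimes> r \<otimes> e) = \<zero>" .
  moreover have "r \<otimes> e \<ominus> e \<otimes> r \<otimes> e \<in> I"
    using assms(3) c by (simp add: a_minus_def I_l_closed)
  ultimately have "r \<otimes> e \<ominus> e \<otimes> r \<otimes> e = \<zero>"
    using assms(2) unfolding reduced_set_def by simp
  then have 2: "r \<otimes> e = e \<otimes> r \<otimes> e"
    using r_right_minus_eq[of "r \<otimes> e" "e \<otimes> r \<otimes> e"] c by (simp only: m_closed)
  show ?thesis by (rule trans[OF 1 2[symmetric]])
qed

text \<open>
  The hypotheses make \<open>f\<close> an idempotent and \<open>a\<close>, \<open>z\<close> mutually inverse in the corner ring \<open>fRf\<close>; an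
  inverse of \<open>a\<^sup>2\<close> in the corner extends by the identity on the complementary corner.
\<close>

lemma corner_square_plus_complement_Unit:
  assumes c: "a \<in> carrier R" "z \<in> carrier R" "f \<in> carrier R"
    and "a \<otimes> z = f" "z \<otimes> a = f" "f \<otimes> a = a" "f \<otimes> z = z"
  shows "a \<otimes> a \<oplus> (\<one> \<ominus> f) \<in> Units R"
proof -
  have af: "a \<otimes> f = a" using m_assoc[OF c(1,2,1)] assms(4-6) by simp
  have zf: "z \<otimes> f = z" using m_assoc[OF c(2,1,2)] assms(4,5,7) by simp
  have ff: "f \<otimes> f = f" using m_assoc[OF c(3,1,2)] assms(4,6) by simp
  \<comment> \<open>Proved for a pair \<open>u\<close>, \<open>v\<close>, since both orders of \<open>a\<close> and \<open>z\<close> are needed for a two-sided unit.\<close>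
  have expand: "(u \<otimes> u \<oplus> (\<one> \<ominus> f)) \<otimes> (v \<otimes> v \<oplus> (\<one> \<ominus> f)) = \<one>"
    if "u \<in> carrier R" "v \<in> carrier R" "u \<otimes> v = f" "u \<otimes> f = u" "f \<otimes> v = v" for u v
  proof -
    have "(u \<otimes> u \<oplus> (\<one> \<ominus> f)) \<otimes> (v \<otimes> v \<oplus> (\<one> \<ominus> f))
        = u \<otimes> (u \<otimes> v) \<otimes> v \<oplus> u \<otimes> (u \<ominus> u \<otimes> f) \<oplus> (v \<ominus> f \<otimes> v) \<otimes> v
          \<oplus> (\<one> \<ominus> f \<ominus> (f \<ominus> f \<otimes> f))"
      using that(1,2) c(3) by (simp add: noncommutative_ring_simps)
    also have "\<dots> = f \<oplus> (\<one> \<ominus> f)"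
      using that c(3) ff by (simp add: a_minus_def r_neg)
    also have "\<dots> = \<one>" using c(3) by (simp add: noncommutative_ring_simps)
    finally show ?thesis .
  qed
  have "(a \<otimes> a \<oplus> (\<one> \<ominus> f)) \<otimes> (z \<otimes> z \<oplus> (\<one> \<ominus> f)) = \<one>"
    using expand assms af by simp
  moreover have "(z \<otimes> z \<oplus> (\<one> \<ominus> f)) \<otimes> (a \<otimes> a \<oplus> (\<one> \<ominus> f)) = \<one>"
    using expand assms zf by simp
  ultimately show ?thesis
    unfolding Units_def using c by (auto intro!: bexI[of _ "z \<otimes> z \<oplus> (\<one> \<ominus> f)"])
qed

section \<open>Ideals without elements of square zero satisfy both conditions\<close>

text \<open>
  For \<open>a = axa\<close> in \<open>I\<close>, centrality makes the idempotents \<open>e = ax\<close> and \<open>g = xa\<close> coincide, so \<open>a\<close>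
  is invertible in the ring factor \<open>eR\<close> and zero in the other factor. There, \<open>as + bt = 1\<close>
  becomes \<open>bt = 1\<close>, so that \<open>bt(1 - e) = 1 - e\<close> is what \<open>a\<^sup>2\<close> lacks to be a unit.
\<close>

lemma square_stable_if_reduced:
  assumes "regular_ideal R I" "reduced_set R I"
  shows "square_stable R I"
  unfolding square_stable_def
proof (intro ballI impI)
  have I: "ideal I R" using assms by (simp add: regular_ideal_def)
  fix a b
  assume aI: "a \<in> I" and b: "b \<in> carrier R"
    and comax: "(a <# carrier R) <+> (b <# carrier R) = carrier R"
  obtain x where a: "a \<in> carrier R" and x: "x \<in> carrier R" and axa: "a \<otimes> x \<otimes> a = a"
      and axI: "a \<otimes> x \<in> I" and xaI: "x \<otimes> a \<in> I"
    by (rule regular_idealE[OF assms(1) aI]) blast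
  obtain s t where st: "s \<in> carrier R" "t \<in> carrier R" "a \<otimes> s \<oplus> b \<otimes> t = \<one>"
    using comaximalE[OF comax] by blast
  define e where "e = a \<otimes> x"
  define g where "g = x \<otimes> a"
  define z where "z = e \<otimes> x"
  have c: "e \<in> carrier R" "g \<in> carrier R" "z \<in> carrier R" using a x by (auto simp: e_def g_def z_def)
  have ea: "e \<otimes> a = a" and ag: "a \<otimes> g = a"
    using axa a x by (simp_all add: e_def g_def m_assoc)
  have ee: "e \<otimes> e = e" using ea a x c by (simp add: e_def m_assoc [symmetric])
  have gg: "g \<otimes> g = g" using ag a x c by (simp add: g_def m_assoc)
  have e_central: "e \<otimes> r = r \<otimes> e" if "r \<in> carrier R" for r
    using idempotent_central_if_reduced[OF I assms(2) _ ee that] axI by (simp add: e_def)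
  have g_central: "g \<otimes> r = r \<otimes> g" if "r \<in> carrier R" for r
    using idempotent_central_if_reduced[OF I assms(2) _ gg that] xaI by (simp add: g_def)
  have ga: "g \<otimes> a = a" using g_central[OF a] ag by simp
  have ae: "a \<otimes> e = a" using e_central[OF a] ea by simp
  have "g \<otimes> e = e" using ga a x c by (simp add: e_def m_assoc [symmetric])
  moreover have "g \<otimes> e = g" using ae a x c by (simp add: g_def m_assoc)
  ultimately have eg: "g = e" by simp
  have "a \<otimes> z = a \<otimes> e \<otimes> x" using a x c by (simp add: z_def m_assoc)
  then have "a \<otimes> z = e" unfolding ae by (simp add: e_def)
  moreover have "z \<otimes> a = e \<otimes> g" using a x c by (simp add: z_def g_def m_assoc)
  then have "z \<otimes> a = e" by (simp add: eg ee)
  moreover have "e \<otimes> z = z"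
    using a x c ee by (simp add: z_def m_assoc [symmetric])
  ultimately have unit: "a \<otimes> a \<oplus> (\<one> \<ominus> e) \<in> Units R"
    using corner_square_plus_complement_Unit a c ea by blast
  have "b \<otimes> (t \<otimes> (\<one> \<ominus> e)) = (\<one> \<ominus> a \<otimes> s) \<otimes> (\<one> \<ominus> e)"
  proof -
    have "b \<otimes> t = \<one> \<ominus> a \<otimes> s"
      unfolding st(3)[symmetric] using a b st(1,2) by (simp add: noncommutative_ring_simps)
    then show ?thesis using b c st(2) by (simp add: m_assoc [symmetric])
  qed
  also have "\<dots> = \<one> \<ominus> e \<ominus> (a \<otimes> s \<ominus> a \<otimes> s \<otimes> e)" using a c st(1) by (simp add: noncommutative_ring_simps)
  also have "a \<otimes> s \<otimes> e = a \<otimes> s"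
    using a c st ea e_central[of "a \<otimes> s"] by (simp add: m_assoc [symmetric])
  also have "\<one> \<ominus> e \<ominus> (a \<otimes> s \<ominus> a \<otimes> s) = \<one> \<ominus> e" using a c st(1) by (simp add: noncommutative_ring_simps)
  finally have "a [^] (2::nat) \<oplus> b \<otimes> (t \<otimes> (\<one> \<ominus> e)) \<in> Units R"
    using unit a by (simp add: square_eq_mult)
  moreover have "t \<otimes> (\<one> \<ominus> e) \<in> carrier R" using st c by simp
  ultimately show "\<exists>y\<in>carrier R. a [^] (2::nat) \<oplus> b \<otimes> y \<in> Units R" by blast
qed

text \<open>
  Write \<open>a = 1 + d\<close> with \<open>d \<in> I\<close> and \<open>as + bt = 1\<close>. Multiplying this equation by \<open>d\<close> replaces \<open>b\<close>
  by \<open>h = btd\<close>, an element of the regular ideal: \<open>a(1 - sd) = 1 + h\<close>. Then \<open>hR = eR\<close> for a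
  central idempotent \<open>e\<close>. On \<open>eR\<close>, which is contained in \<open>bR\<close>, a multiple of \<open>b\<close> can
  change \<open>a\<^sup>2\<close> to the identity. On the factor of \<open>f = 1 - e\<close>, the term \<open>h\<close> vanishes and \<open>a\<close> has the
  right inverse \<open>z = f(1 - sd)\<close>. This is also a left inverse: the defect \<open>g = f - za\<close> is an
  idempotent that lies in \<open>I\<close>, because \<open>a\<close> and \<open>1 - sd\<close> are \<open>1\<close> modulo \<open>I\<close>; so \<open>g\<close> is central, and
  \<open>g = g(az) = a(gz) = 0\<close>.
\<close>

lemma square_condition_on_one_plus_if_reduced:
  assumes "regular_ideal R I" "reduced_set R I" "a \<in> \<one> <+ I" "b \<in> carrier R"
    and comax: "(a <# carrier R) <+> (b <# carrier R) = carrier R"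
  shows "\<exists>y\<in>carrier R. a [^] (2::nat) \<oplus> b \<otimes> y \<in> Units R"
proof -
  have I: "ideal I R" using assms by (simp add: regular_ideal_def)
  interpret ideal I R by (fact I)
  note b = assms(4)
  obtain d where dI: "d \<in> I" and a_eq: "a = \<one> \<oplus> d" using assms(3) by (auto simp: a_l_coset_def')
  have d: "d \<in> carrier R" using dI Icarr by simp
  have a: "a \<in> carrier R" using a_eq d by simp
  obtain s t where st: "s \<in> carrier R" "t \<in> carrier R" "a \<otimes> s \<oplus> b \<otimes> t = \<one>"
    using comaximalE[OF comax] by blast
  define h where "h = b \<otimes> (t \<otimes> d)"
  have "h \<in> I" using dI b st by (simp add: h_def I_l_closed)
  then obtain x where h: "h \<in> carrier R" and x: "x \<in> carrier R" and hxh: "h \<otimes> x \<otimes> h = h"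
      and hxI: "h \<otimes> x \<in> I"
    by (rule regular_idealE[OF assms(1)]) blast
  define e where "e = h \<otimes> x"
  define f where "f = \<one> \<ominus> e"
  have c: "e \<in> carrier R" "f \<in> carrier R" using h x by (simp_all add: e_def f_def)
  have eI: "e \<in> I" using hxI by (simp add: e_def)
  have eh: "e \<otimes> h = h" using hxh by (simp add: e_def)
  have ee: "e \<otimes> e = e" using eh h x c by (simp add: e_def m_assoc [symmetric])
  have e_central: "e \<otimes> r = r \<otimes> e" if "r \<in> carrier R" for r
    using idempotent_central_if_reduced[OF I assms(2) eI ee that] .
  have f_central: "f \<otimes> r = r \<otimes> f" if r: "r \<in> carrier R" for r
  proof -
    have "f \<otimes> r = r \<ominus> e \<otimes> r" using c r unfolding f_def by (simp add: noncommutative_ring_simps)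
    also have "\<dots> = r \<ominus> r \<otimes> e" using e_central r by simp
    also have "\<dots> = r \<otimes> f" using c r unfolding f_def by (simp add: noncommutative_ring_simps)
    finally show ?thesis .
  qed
  have "f \<otimes> f = \<one> \<ominus> e \<ominus> (e \<ominus> e \<otimes> e)" using c unfolding f_def by (simp add: noncommutative_ring_simps)
  then have ff: "f \<otimes> f = f" using c ee by (simp add: f_def a_minus_def r_neg)
  have "f \<otimes> h = h \<ominus> e \<otimes> h" using c h unfolding f_def by (simp add: noncommutative_ring_simps)
  then have fh: "f \<otimes> h = \<zero>" using eh h by (simp add: a_minus_def r_neg)
  define z where "z = f \<otimes> (\<one> \<ominus> s \<otimes> d)"
  have z: "z \<in> carrier R" using c st d by (simp add: z_def)
  have fz: "f \<otimes> z = z" using c st d ff by (simp add: z_def m_assoc [symmetric])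
  have "a \<otimes> (\<one> \<ominus> s \<otimes> d) = a \<ominus> (a \<otimes> s \<oplus> b \<otimes> t) \<otimes> d \<oplus> h"
    using a b d st(1,2) unfolding h_def by (simp add: noncommutative_ring_simps)
  also have "\<dots> = \<one> \<oplus> h" unfolding st(3) unfolding a_eq using d h by (simp add: noncommutative_ring_simps)
  finally have "a \<otimes> (\<one> \<ominus> s \<otimes> d) = \<one> \<oplus> h" .
  moreover have "a \<otimes> z = f \<otimes> (a \<otimes> (\<one> \<ominus> s \<otimes> d))"
    using a c d st(1) f_central[OF a] by (simp add: z_def m_assoc [symmetric])
  ultimately have "a \<otimes> z = f \<otimes> (\<one> \<oplus> h)" by simp
  also have "\<dots> = f" using c h fh by (simp add: r_distr)
  finally have az: "a \<otimes> z = f" .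
  define g where "g = f \<ominus> z \<otimes> a"
  have g: "g \<in> carrier R" using c z a by (simp add: g_def)
  have "g = f \<otimes> (s \<otimes> d \<otimes> a \<ominus> d)"
    unfolding g_def z_def a_eq using c d st(1) by (simp add: noncommutative_ring_simps)
  then have gI: "g \<in> I" using c d dI st a
    by (simp add: a_minus_def I_l_closed I_r_closed)
  have "g \<otimes> z = f \<otimes> z \<ominus> z \<otimes> (a \<otimes> z)" using c z a unfolding g_def by (simp add: noncommutative_ring_simps)
  then have gz: "g \<otimes> z = \<zero>" using c z az fz f_central[of z] by (simp add: a_minus_def r_neg)
  have fg: "f \<otimes> g = g"
  proof -
    have "f \<otimes> g = f \<otimes> f \<ominus> (f \<otimes> z) \<otimes> a" using c z a unfolding g_def by (simp add: noncommutative_ring_simps)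
    then show ?thesis unfolding ff fz g_def .
  qed
  have "g \<otimes> g = g \<otimes> f \<ominus> (g \<otimes> z) \<otimes> a"
    using c(2) g z a by (subst (2) g_def) (simp add: noncommutative_ring_simps)
  then have gg: "g \<otimes> g = g"
    using gz fg f_central[OF g] a g by (simp add: a_minus_def)
  have "g = g \<otimes> (a \<otimes> z)" using az fg f_central[OF g] by simp
  also have "\<dots> = a \<otimes> (g \<otimes> z)"
    using idempotent_central_if_reduced[OF I assms(2) gI gg a] g a z
    by (simp add: m_assoc [symmetric])
  finally have "g = \<zero>" using gz a by simp
  then have za: "z \<otimes> a = f" using c z a by (simp add: g_def)
  have "(f \<otimes> a) \<otimes> z = f" using a c z az ff by (simp add: m_assoc)
  moreover have "z \<otimes> (f \<otimes> a) = f"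
    using a c z za fz f_central[OF z] by (simp add: m_assoc [symmetric])
  moreover have "f \<otimes> (f \<otimes> a) = f \<otimes> a" using a c ff by (simp add: m_assoc [symmetric])
  ultimately have "(f \<otimes> a) \<otimes> (f \<otimes> a) \<oplus> (\<one> \<ominus> f) \<in> Units R"
    using corner_square_plus_complement_Unit[of "f \<otimes> a" z f] a c z fz by simp
  moreover have "(f \<otimes> a) \<otimes> (f \<otimes> a) = a \<otimes> a \<ominus> e \<otimes> (a \<otimes> a)"
  proof -
    have "(f \<otimes> a) \<otimes> (f \<otimes> a) = f \<otimes> (a \<otimes> f) \<otimes> a" using a c by (simp add: m_assoc)
    also have "\<dots> = (f \<otimes> f) \<otimes> (a \<otimes> a)"
      unfolding f_central[OF a, symmetric] using a c by (simp add: m_assoc)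
    finally have "(f \<otimes> a) \<otimes> (f \<otimes> a) = f \<otimes> (a \<otimes> a)" by (simp add: ff)
    then show ?thesis using a c unfolding f_def by (simp add: noncommutative_ring_simps)
  qed
  moreover have "\<one> \<ominus> f = e" using c unfolding f_def by (simp add: noncommutative_ring_simps)
  ultimately have unit: "a \<otimes> a \<ominus> e \<otimes> (a \<otimes> a) \<oplus> e \<in> Units R" by simp
  \<comment> \<open>As \<open>btdx = hx = e\<close>, adding \<open>by\<close> replaces the component of \<open>a\<^sup>2\<close> in \<open>eR\<close> by \<open>e\<close>.\<close>
  define y where "y = t \<otimes> d \<otimes> x \<otimes> (\<one> \<ominus> a \<otimes> a)"
  have y: "y \<in> carrier R" using st d x a by (simp add: y_def)
  have "b \<otimes> y = e \<otimes> (\<one> \<ominus> a \<otimes> a)"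
    using b st d x a by (simp add: y_def e_def h_def m_assoc)
  then have "a \<otimes> a \<oplus> b \<otimes> y = a \<otimes> a \<ominus> e \<otimes> (a \<otimes> a) \<oplus> e" using a c(1) by (simp add: noncommutative_ring_simps)
  then have "a [^] (2::nat) \<oplus> b \<otimes> y \<in> Units R" using unit a by (simp add: square_eq_mult)
  then show ?thesis using y by blast
qed

end

section \<open>The equivalence\<close>

theorem theorem3p6:
  fixes R :: "('a, 'm) ring_scheme" (structure) and I :: "'a set"
  assumes "ring R" and "regular_ideal R I"
  shows "square_stable R I \<longleftrightarrow>
    (\<forall>a \<in> \<one> <+ I. \<forall>b \<in> carrier R.
       (a <# carrier R) <+> (b <# carrier R) = carrier R \<longrightarrow>
       (\<exists>y\<in>carrier R. (a [^] (2::nat)) \<oplus> (b \<otimes> y) \<in> Units R))"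
proof -
  interpret ring R by fact
  have "square_stable R I \<longleftrightarrow> reduced_set R I"
    using reduced_if_square_stable square_stable_if_reduced assms(2) by blast
  also have "\<dots> \<longleftrightarrow> (\<forall>a \<in> \<one> <+ I. \<forall>b \<in> carrier R.
       (a <# carrier R) <+> (b <# carrier R) = carrier R \<longrightarrow>
       (\<exists>y\<in>carrier R. (a [^] (2::nat)) \<oplus> (b \<otimes> y) \<in> Units R))" (is "_ \<longleftrightarrow> ?cond")
  proof
    show ?cond if "reduced_set R I"
      using square_condition_on_one_plus_if_reduced[OF assms(2) that] by blast
    show "reduced_set R I" if ?cond
      using reduced_if_square_condition_on_one_plus[OF assms(2) that] .
  qed
  finally show ?thesis .
qed

end
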